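(* Let $\alpha\in(0,1)$, $\alpha_1\in[0,1]$, $0<\gamma\le1$ and let $T\ge1$ be an integer. Run the update $$\alpha_{t+1}=\alpha_t+\gamma(\alpha-M_t),\qquad t=1,\dots,T,$$ without truncation, where $M_t\in\{0,1\}$ is the indicator that the response $Y_t$ is not in the prediction interval used at time $t$ with level $\alpha_t$, under the conventions that the interval is the whole real line when $\alpha_t\le0$ (so $M_t=0$) and is empty when $\alpha_t\ge1$ (so $M_t=1$). Then, for every data sequence (without independence, stationarity, or a correctly specified forecasting model): (i) $\displaystyle \frac1T\sum_{t=1}^TM_t=\alpha+\frac{\alpha_1-\alpha_{T+1}}{\gamma T}$; (ii) $\alpha_t\in[-\gamma,1+\gamma]$ for every $t\in\{1,\dots,T+1\}$; (iii) $\displaystyle \left|\frac1T\sum_{t=1}^TM_t-\alpha\right|\le\frac{1+\gamma}{\gamma T}$.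
   Context: $\alpha$ is the target miscoverage level and $\gamma$ the learning rate. When $\alpha_t\in(0,1)$, the interval at time $t$ is $\widehat C_t=[\widehat f(X_t)-q_t(\alpha_t),\ \widehat f(X_t)+q_t(\alpha_t)]$, where $\widehat f$ is a fitted prediction rule, $q_t(a)=\inf\{q:\sum_{i\in\mathcal I_{\mathrm{cal}}}w_{t,i}\mathbf 1\{R_i\le q\}\ge1-a\}$, $\mathcal I_{\mathrm{cal}}$ is a finite nonempty calibration index set, $R_i=|Y_i-\widehat f(X_i)|$ are calibration residuals, and $w_{t,i}\ge0$ are weights with $\sum_{i\in\mathcal I_{\mathrm{cal}}}w_{t,i}=1$. $M_t=\mathbf 1\{Y_t\notin\widehat C_t\}$, with $Y_t\in\mathbb R$. The statement is deterministic: it holds for every realization of the data. *)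

theory Defs
  imports Complex_Main
begin

definition abs_residual :: "('x \<Rightarrow> real) \<Rightarrow> 'x \<Rightarrow> real \<Rightarrow> real" where
  "abs_residual fhat x y = \<bar>y - fhat x\<bar>"

(* For nonnegative weights with total 1 over a finite nonempty index set and 0 < a < 1, the set below
   is nonempty and bounded below, so Inf is the genuine infimum. The definition is only
   used for such a. *)
definition weighted_quantile :: "'i set \<Rightarrow> ('i \<Rightarrow> real) \<Rightarrow> ('i \<Rightarrow> real) \<Rightarrow> real \<Rightarrow> real" where
  "weighted_quantile I w R a = Inf {q. (\<Sum>i\<in>I. w i * of_bool (R i \<le> q)) \<ge> 1 - a}"

definition prediction_interval ::
    "('x \<Rightarrow> real) \<Rightarrow> 'i set \<Rightarrow> ('i \<Rightarrow> real) \<Rightarrow> ('i \<Rightarrow> real) \<Rightarrow> 'x \<Rightarrow> real \<Rightarrow> real set" where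
  "prediction_interval fhat I w R x a =
     (if a \<le> 0 then UNIV
      else if a \<ge> 1 then {}
      else {fhat x - weighted_quantile I w R a .. fhat x + weighted_quantile I w R a})"

end

theory Submission
  imports Defs
begin

text \<open>
  Summing the update telescopes, which gives (i). For (ii), a step moves the level by less than
  \<open>\<gamma>\<close>, and the conventions outside \<open>(0, 1)\<close> force the step towards the unit interval: upwards when
  the level is at most \<open>0\<close> and downwards when it is at least \<open>1\<close>.
  Then (iii) follows from (i) and (ii).
\<close>

text \<open>Written without dividing by \<open>\<gamma>\<close> or \<open>T\<close>, so that the
  induction can start at the empty sum \<open>T = 0\<close>.\<close>

lemma online_update_telescope:
  fixes a M :: "nat \<Rightarrow> real"
  assumes "\<And>t. t \<in> {1..T} \<Longrightarrow> a (t + 1) = a t + \<gamma> * (\<alpha> - M t)"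
  shows "a (T + 1) = a 1 + \<gamma> * (real T * \<alpha> - (\<Sum>t=1..T. M t))"
  using assms
proof (induction T)
  case (Suc T)
  then have "a (T + 1) = a 1 + \<gamma> * (real T * \<alpha> - (\<Sum>t=1..T. M t))"
    by simp
  moreover have "a (Suc T + 1) = a (T + 1) + \<gamma> * (\<alpha> - M (Suc T))"
    using Suc.prems[of "Suc T"] by simp
  ultimately show ?case
    by (simp add: algebra_simps)
qed simp

text \<open>For \<open>a\<close> strictly between 0 and 1, a move shorter than
  \<open>\<gamma>\<close> cannot leave the enlarged interval. From \<open>a \<le> 0\<close> the move
  is upwards and ends below \<open>\<gamma>\<close>; from \<open>1 \<le> a\<close> it is downwards
  and ends above \<open>1 - \<gamma>\<close>.\<close>

lemma online_update_step_bounds: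
  fixes a m \<alpha> \<gamma> :: real
  assumes "0 < \<alpha>" "\<alpha> < 1" "0 < \<gamma>"
    and "m \<in> {0, 1}" "a \<le> 0 \<Longrightarrow> m = 0" "1 \<le> a \<Longrightarrow> m = 1"
    and "a \<in> {- \<gamma>..1 + \<gamma>}"
  shows "a + \<gamma> * (\<alpha> - m) \<in> {- \<gamma>..1 + \<gamma>}"
proof -
  \<comment> \<open>The increment is \<open>\<gamma> * \<alpha>\<close> if \<open>m = 0\<close> and
    \<open>\<gamma> * \<alpha> - \<gamma>\<close> if \<open>m = 1\<close>; with these two bounds on
    the product every case is linear.\<close>
  have "0 < \<gamma> * \<alpha>" "\<gamma> * \<alpha> < \<gamma>"
    using assms(1-3) by simp_all
  with assms(4-7) show ?thesis
    by (cases "a \<le> 0"; cases "1 \<le> a") (auto simp: right_diff_distrib)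
qed

theorem proposition2:
  fixes \<alpha> \<gamma> :: real and T :: nat
    and fhat :: "'x \<Rightarrow> real"
    and I_cal :: "'i set" and X_cal :: "'i \<Rightarrow> 'x" and Y_cal :: "'i \<Rightarrow> real" and R :: "'i \<Rightarrow> real"
    and w :: "nat \<Rightarrow> 'i \<Rightarrow> real"
    and X :: "nat \<Rightarrow> 'x" and Y :: "nat \<Rightarrow> real"
    and \<alpha>s :: "nat \<Rightarrow> real" and M :: "nat \<Rightarrow> real"
  assumes "0 < \<alpha>" and "\<alpha> < 1"
    and "0 < \<gamma>" and "\<gamma> \<le> 1"
    and "T \<ge> 1"
    and "finite I_cal" and "I_cal \<noteq> {}"
    and "\<And>i. i \<in> I_cal \<Longrightarrow> R i = abs_residual fhat (X_cal i) (Y_cal i)"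
    and "\<And>t i. t \<in> {1..T} \<Longrightarrow> i \<in> I_cal \<Longrightarrow> w t i \<ge> 0"
    and "\<And>t. t \<in> {1..T} \<Longrightarrow> (\<Sum>i\<in>I_cal. w t i) = 1"
    and "\<And>t. t \<in> {1..T} \<Longrightarrow>
           M t = of_bool (Y t \<notin> prediction_interval fhat I_cal (w t) R (X t) (\<alpha>s t))"
    and "\<alpha>s 1 \<in> {0..1}"
    and "\<And>t. t \<in> {1..T} \<Longrightarrow> \<alpha>s (t + 1) = \<alpha>s t + \<gamma> * (\<alpha> - M t)"
  shows "(1 / real T) * (\<Sum>t=1..T. M t) = \<alpha> + (\<alpha>s 1 - \<alpha>s (T + 1)) / (\<gamma> * real T)
       \<and> (\<forall>t\<in>{1..T + 1}. \<alpha>s t \<in> {- \<gamma>..1 + \<gamma>})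
       \<and> \<bar>(1 / real T) * (\<Sum>t=1..T. M t) - \<alpha>\<bar> \<le> (1 + \<gamma>) / (\<gamma> * real T)"
proof (intro conjI)
  have diff: "\<alpha>s 1 - \<alpha>s (T + 1) = \<gamma> * ((\<Sum>t=1..T. M t) - real T * \<alpha>)"
    using online_update_telescope[of T \<alpha>s \<gamma> \<alpha> M] assms(13) by (simp add: algebra_simps)
  have avg: "(1 / real T) * (\<Sum>t=1..T. M t) - \<alpha> = (\<alpha>s 1 - \<alpha>s (T + 1)) / (\<gamma> * real T)"
    unfolding diff using assms(3,5) by (simp add: diff_divide_distrib)
  then show "(1 / real T) * (\<Sum>t=1..T. M t) = \<alpha> + (\<alpha>s 1 - \<alpha>s (T + 1)) / (\<gamma> * real T)"
    by simp
  have bounds: "\<alpha>s t \<in> {- \<gamma>..1 + \<gamma>}" if "1 \<le> t" "t \<le> T + 1" for t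
    using that
  proof (induction t rule: dec_induct)
    case base
    then show ?case
      using assms(3,12) by auto
  next
    case (step t)
    then have t: "t \<in> {1..T}" and IH: "\<alpha>s t \<in> {- \<gamma>..1 + \<gamma>}"
      by auto
    \<comment> \<open>\<open>UNIV\<close> is never missed and the empty interval always is, whence
      the two implications.\<close>
    have "M t \<in> {0, 1}" "\<alpha>s t \<le> 0 \<Longrightarrow> M t = 0" "1 \<le> \<alpha>s t \<Longrightarrow> M t = 1"
      using assms(11)[OF t] by (auto simp: prediction_interval_def)
    from online_update_step_bounds[OF assms(1-3) this IH] show ?case
      using assms(13)[OF t] by simp
  qed
  then show "\<forall>t\<in>{1..T + 1}. \<alpha>s t \<in> {- \<gamma>..1 + \<gamma>}"
    by simp
  \<comment> \<open>The initial level lies in the unit interval itself; the enlarged range for both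
    levels would only give \<open>1 + 2 * \<gamma>\<close>.\<close>
  have "\<bar>\<alpha>s 1 - \<alpha>s (T + 1)\<bar> \<le> 1 + \<gamma>"
    using bounds[of "T + 1"] assms(12) by auto
  then show "\<bar>(1 / real T) * (\<Sum>t=1..T. M t) - \<alpha>\<bar> \<le> (1 + \<gamma>) / (\<gamma> * real T)"
    unfolding avg abs_divide using assms(3) by (simp add: divide_right_mono)
qed

end
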